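(* Let $n\geq 2$ and $M\leq n!$ be positive integers. For $\mathcal{F}\subseteq S_n$ with $|\mathcal{F}|=M$, we have $$\mathcal{MI}(\mathcal{F})\leq\frac{M^2}{n-1}\left(\frac{n!}{M}+n-2\right).$$
   Context: $S_n$ is the symmetric group of all permutations of $[n]=\{1,\ldots,n\}$. For $\mathcal{F}\subseteq S_n$, the total intersection number is $\mathcal{I}(\mathcal{F})=\sum_{A\in\mathcal{F}}\sum_{B\in\mathcal{F}}|\{i\in[n]:A(i)=B(i)\}|$ (sum over ordered pairs, including $A=B$), and $\mathcal{MI}(\mathcal{F})=\max\{\mathcal{I}(\mathcal{G}):\mathcal{G}\subseteq S_n,\ |\mathcal{G}|=|\mathcal{F}|\}$. *)

theory Defs
  imports Complex_Main "HOL-Combinatorics.Permutations"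
begin

text \<open>Permutations of \<open>{1..n}\<close> are represented, as in the library, by functions on
  \<open>nat\<close> that are the identity outside \<open>{1..n}\<close>; equality of such functions is
  therefore equality of permutations.\<close>

definition sym_perms :: "nat \<Rightarrow> (nat \<Rightarrow> nat) set" where
  "sym_perms n = {p. p permutes {1..n}}"

definition total_intersection :: "nat \<Rightarrow> (nat \<Rightarrow> nat) set \<Rightarrow> nat" where
  "total_intersection n F = (\<Sum>A\<in>F. \<Sum>B\<in>F. card {i \<in> {1..n}. A i = B i})"

text \<open>For \<open>F \<subseteq> sym_perms n\<close> the maximum ranges over a finite set that contains
  \<open>total_intersection n F\<close>.\<close>

definition max_total_intersection :: "nat \<Rightarrow> (nat \<Rightarrow> nat) set \<Rightarrow> nat" where
  "max_total_intersection n F =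
     Max {total_intersection n G | G. G \<subseteq> sym_perms n \<and> card G = card F}"

end

theory Submission
  imports Defs
begin

text \<open>Let \<open>b i j\<close> be the number of \<open>A \<in> G\<close> with \<open>A i = j\<close>, minus its mean \<open>M / n\<close>. All row and
  column sums of \<open>b\<close> vanish, and the total intersection of \<open>G\<close> is \<open>M\<^sup>2 + S\<close> with
  \<open>S = \<Sum>i j. (b i j)\<^sup>2\<close>. The function \<open>g A = \<Sum>i. b i (A i)\<close> on the symmetric group sums to \<open>0\<close>,
  sums to \<open>S\<close> over \<open>G\<close>, and has squared norm \<open>n! / (n - 1) * S\<close>. Hence the squared norm of
  \<open>1\<^sub>G - M / n! - t g\<close> with \<open>t = (n - 1) / n!\<close> is \<open>M - M\<^sup>2 / n! - t S\<close>, and this is nonnegative.\<close>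

section \<open>Counting permutations with prescribed values\<close>

text \<open>Left composition with the transposition of \<open>j\<close> and \<open>j'\<close> is an
  involution exchanging the two sets. The invariant side condition \<open>Q\<close> allows the value
  at a second point to be kept fixed.\<close>

lemma card_permutes_transpose_value:
  assumes "j \<in> S" "j' \<in> S"
    and "\<And>p. Q (transpose j j' \<circ> p) \<longleftrightarrow> Q p"
  shows "card {p. p permutes S \<and> Q p \<and> p i = j} = card {p. p permutes S \<and> Q p \<and> p i = j'}"
proof (rule bij_betw_same_card)
  have inv: "transpose j j' \<circ> (transpose j j' \<circ> p) = p" for p :: "'a \<Rightarrow> 'a"
    by (simp add: fun_eq_iff)
  show "bij_betw (\<lambda>p. transpose j j' \<circ> p) {p. p permutes S \<and> Q p \<and> p i = j}
          {p. p permutes S \<and> Q p \<and> p i = j'}"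
    by (rule bij_betw_byWitness[where f' = "\<lambda>p. transpose j j' \<circ> p"])
      (use assms inv in \<open>auto intro!: permutes_compose permutes_swap_id\<close>)
qed

text \<open>The permutations split into \<open>card S\<close> classes by their value at
  \<open>i\<close>, and transpositions show that the classes are equally large. The product form
  avoids division of naturals.\<close>

lemma card_permutes_value:
  assumes "finite S" "i \<in> S" "j \<in> S"
  shows "card S * card {p. p permutes S \<and> p i = j} = fact (card S)"
proof -
  have eq: "card {p. p permutes S \<and> p i = j'} = card {p. p permutes S \<and> p i = j}" if "j' \<in> S" for j'
    using card_permutes_transpose_value[of j' S j "\<lambda>_. True" i] that assms by simp
  have "fact (card S) = card (\<Union>j'\<in>S. {p. p permutes S \<and> p i = j'})"
    using card_permutations[OF refl assms(1)] assms(2)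
    by (auto intro!: arg_cong[where f = card] simp: permutes_in_image
        simp flip: card_permutations[OF refl assms(1)])
  also have "\<dots> = (\<Sum>j'\<in>S. card {p. p permutes S \<and> p i = j'})"
    by (rule card_UN_disjoint) (use assms finite_permutations[OF assms(1)] in auto)
  also have "\<dots> = (\<Sum>j'\<in>S. card {p. p permutes S \<and> p i = j})"
    by (rule sum.cong[OF refl eq])
  finally show ?thesis by simp
qed

text \<open>Among the permutations with \<open>p i = j\<close>, the value at \<open>k\<close> ranges
  over \<open>S - {j}\<close>, and all these values occur equally often.\<close>

lemma card_permutes_two_values:
  assumes "finite S" "i \<in> S" "k \<in> S" "i \<noteq> k" "j \<in> S" "l \<in> S" "j \<noteq> l"
  shows "(card S - 1) * card {p. p permutes S \<and> p i = j \<and> p k = l}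
    = card {p. p permutes S \<and> p i = j}"
proof -
  have eq: "card {p. p permutes S \<and> p i = j \<and> p k = l'} = card {p. p permutes S \<and> p i = j \<and> p k = l}"
    if "l' \<in> S - {j}" for l'
  proof -
    \<comment> \<open>Both swapped values differ from \<open>j\<close>, so the condition
      \<open>p i = j\<close> survives the transposition.\<close>
    have "transpose l' l x = j \<longleftrightarrow> x = j" for x
      using that assms(7) by (auto simp: transpose_def)
    then show ?thesis
      using card_permutes_transpose_value[of l' S l "\<lambda>p. p i = j" k] that assms by simp
  qed
  have "{p. p permutes S \<and> p i = j} = (\<Union>l'\<in>S - {j}. {p. p permutes S \<and> p i = j \<and> p k = l'})"
    using assms(3,4) by (auto simp: permutes_in_image permutes_inj[THEN inj_eq])
  also have "card \<dots> = (\<Sum>l'\<in>S - {j}. card {p. p permutes S \<and> p i = j \<and> p k = l'})"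
    by (rule card_UN_disjoint) (use assms finite_permutations[OF assms(1)] in auto)
  also have "\<dots> = (\<Sum>l'\<in>S - {j}. card {p. p permutes S \<and> p i = j \<and> p k = l})"
    by (rule sum.cong[OF refl eq])
  also have "\<dots> = (card S - 1) * card {p. p permutes S \<and> p i = j \<and> p k = l}"
    using assms by simp
  finally show ?thesis by simp
qed

section \<open>First and second moments over the symmetric group\<close>

lemma sum_by_value:
  fixes f :: "'b \<Rightarrow> real"
  assumes "finite G" "finite S" "\<And>A. A \<in> G \<Longrightarrow> h A \<in> S"
  shows "(\<Sum>A\<in>G. f (h A)) = (\<Sum>s\<in>S. real (card {A \<in> G. h A = s}) * f s)"
proof -
  have "(\<Sum>A\<in>G. f (h A)) = (\<Sum>s\<in>S. \<Sum>A | A \<in> G \<and> h A = s. f (h A))"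
    using assms by (intro sum.group[symmetric]) auto
  also have "\<dots> = (\<Sum>s\<in>S. real (card {A \<in> G. h A = s}) * f s)"
    by (intro sum.cong refl) simp
  finally show ?thesis .
qed

lemma sum_permutes_value:
  fixes f :: "'a \<Rightarrow> real"
  assumes "finite S" "i \<in> S"
  shows "(\<Sum>p | p permutes S. f (p i)) = fact (card S) / card S * sum f S"
proof -
  have c: "real (card {p. p permutes S \<and> p i = j}) = fact (card S) / card S" if "j \<in> S" for j
  proof -
    have "real (card S) * real (card {p. p permutes S \<and> p i = j}) = fact (card S)"
      using card_permutes_value[OF assms that] by (metis of_nat_fact of_nat_mult)
    moreover have "card S \<noteq> 0" using assms by auto
    ultimately show ?thesis by (simp add: field_simps)
  qed
  have "(\<Sum>p | p permutes S. f (p i))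
      = (\<Sum>j\<in>S. real (card {p \<in> {p. p permutes S}. p i = j}) * f j)"
    using assms by (intro sum_by_value finite_permutations) (auto simp: permutes_in_image)
  then show ?thesis by (simp add: c sum_distrib_left)
qed

text \<open>For a uniformly random \<open>p\<close>, the pair \<open>(p i, p k)\<close> is uniform
  on the \<open>card S * (card S - 1)\<close> ordered pairs of distinct elements.\<close>

lemma sum_permutes_two_values:
  fixes f :: "'a \<Rightarrow> 'a \<Rightarrow> real"
  assumes "finite S" "i \<in> S" "k \<in> S" "i \<noteq> k"
  shows "(\<Sum>p | p permutes S. f (p i) (p k))
    = fact (card S) / (card S * (real (card S) - 1)) * (\<Sum>j\<in>S. \<Sum>l\<in>S - {j}. f j l)"
proof -
  \<comment> \<open>Two distinct points force \<open>card S \<ge> 2\<close>, so the subtraction in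
    \<open>card S - 1\<close> is not truncated and the denominator is nonzero.\<close>
  have "card {i, k} \<le> card S" using assms by (intro card_mono) auto
  then have n: "card S \<ge> 2" using assms by simp
  define c where "c = fact (card S) / (card S * (real (card S) - 1))"
  have c: "real (card {p. p permutes S \<and> p i = j \<and> p k = l}) = c"
    if "j \<in> S" "l \<in> S - {j}" for j l
  proof -
    have "card S * ((card S - 1) * card {p. p permutes S \<and> p i = j \<and> p k = l}) = fact (card S)"
      using card_permutes_value[of S i j] card_permutes_two_values[of S i k j l] assms that by force
    then have "real (card S * ((card S - 1) * card {p. p permutes S \<and> p i = j \<and> p k = l}))
        = fact (card S)" by simp
    then show ?thesis using n by (simp add: c_def of_nat_diff field_simps)
  qed
  have "(\<Sum>p | p permutes S. f (p i) (p k)) = (\<Sum>p | p permutes S. case_prod f (p i, p k))"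
    by simp
  also have "\<dots> = (\<Sum>s\<in>Sigma S (\<lambda>j. S - {j}).
      real (card {p \<in> {p. p permutes S}. (p i, p k) = s}) * case_prod f s)"
    using assms by (intro sum_by_value finite_permutations)
      (auto simp: permutes_in_image permutes_inj[THEN inj_eq])
  also have "\<dots> = (\<Sum>s\<in>Sigma S (\<lambda>j. S - {j}). c * case_prod f s)"
    by (rule sum.cong) (auto simp: c)
  also have "\<dots> = c * (\<Sum>j\<in>S. \<Sum>l\<in>S - {j}. f j l)"
    using assms by (simp add: sum.Sigma sum_distrib_left)
  finally show ?thesis by (simp add: c_def)
qed

text \<open>Expanding the square, the terms with \<open>i = k\<close> give
  \<open>fact n / n * T\<close>. The terms with \<open>i \<noteq> k\<close> give
  \<open>d * T\<close>: the vanishing row sums and then the vanishing column sums each contribute a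
  minus sign.\<close>

lemma sum_square_permutes:
  fixes b :: "'a \<Rightarrow> 'a \<Rightarrow> real"
  assumes "finite S" "card S \<ge> 2"
    and row: "\<And>i. i \<in> S \<Longrightarrow> (\<Sum>j\<in>S. b i j) = 0"
    and col: "\<And>j. j \<in> S \<Longrightarrow> (\<Sum>i\<in>S. b i j) = 0"
  shows "(\<Sum>p | p permutes S. (\<Sum>i\<in>S. b i (p i))\<^sup>2)
    = fact (card S) / (real (card S) - 1) * (\<Sum>i\<in>S. \<Sum>j\<in>S. (b i j)\<^sup>2)"
proof -
  define n where "n = card S"
  define T where "T = (\<Sum>i\<in>S. \<Sum>j\<in>S. (b i j)\<^sup>2)"
  define d where "d = fact n / (n * (real n - 1))"
  have off: "(\<Sum>p | p permutes S. b i (p i) * b k (p k)) = - d * (\<Sum>j\<in>S. b i j * b k j)"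
    if "i \<in> S" "k \<in> S - {i}" for i k
  proof -
    \<comment> \<open>As row \<open>k\<close> sums to zero, omitting the entry at \<open>j\<close>
      leaves \<open>- b k j\<close>.\<close>
    have "(\<Sum>l\<in>S - {j}. b i j * b k l) = - (b i j * b k j)" if "j \<in> S" for j
      using row[of k] \<open>k \<in> S - {i}\<close> that assms(1)
      by (simp add: sum_diff1 flip: sum_distrib_left)
    then show ?thesis
      using sum_permutes_two_values[of S i k "\<lambda>j l. b i j * b k l"] that assms(1)
      by (force simp: d_def n_def sum_negf)
  qed
  have cross: "(\<Sum>k\<in>S - {i}. \<Sum>j\<in>S. b i j * b k j) = - (\<Sum>j\<in>S. (b i j)\<^sup>2)" if "i \<in> S" for i
  proof -
    \<comment> \<open>The same argument applies to column \<open>j\<close>.\<close>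
    have "(\<Sum>k\<in>S - {i}. b i j * b k j) = - (b i j)\<^sup>2" if "j \<in> S" for j
      using col[of j] \<open>i \<in> S\<close> that assms(1)
      by (simp add: sum_diff1 power2_eq_square flip: sum_distrib_left)
    then show ?thesis
      by (subst sum.swap) (simp add: sum_negf)
  qed
  have "(\<Sum>p | p permutes S. (\<Sum>i\<in>S. b i (p i))\<^sup>2)
      = (\<Sum>i\<in>S. \<Sum>k\<in>S. \<Sum>p | p permutes S. b i (p i) * b k (p k))"
    unfolding power2_eq_square sum_product
    by (subst sum.swap, intro sum.cong refl, subst sum.swap, rule refl)
  also have "\<dots> = (\<Sum>i\<in>S. (fact n / n + d) * (\<Sum>j\<in>S. (b i j)\<^sup>2))"
  proof (intro sum.cong refl)
    fix i assume i: "i \<in> S"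
    have "(\<Sum>k\<in>S. \<Sum>p | p permutes S. b i (p i) * b k (p k))
        = (\<Sum>p | p permutes S. (b i (p i))\<^sup>2)
          + (\<Sum>k\<in>S - {i}. \<Sum>p | p permutes S. b i (p i) * b k (p k))"
      using i assms(1) by (simp add: sum.remove power2_eq_square)
    also have "(\<Sum>p | p permutes S. (b i (p i))\<^sup>2) = fact n / n * (\<Sum>j\<in>S. (b i j)\<^sup>2)"
      using sum_permutes_value[of S i "\<lambda>j. (b i j)\<^sup>2"] i assms(1) by (simp add: n_def)
    also have "(\<Sum>k\<in>S - {i}. \<Sum>p | p permutes S. b i (p i) * b k (p k))
        = - d * (\<Sum>k\<in>S - {i}. \<Sum>j\<in>S. b i j * b k j)"
      by (simp add: off[OF i] sum_distrib_left sum_negf)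
    finally show "(\<Sum>k\<in>S. \<Sum>p | p permutes S. b i (p i) * b k (p k))
        = (fact n / n + d) * (\<Sum>j\<in>S. (b i j)\<^sup>2)"
      unfolding cross[OF i] by (simp add: distrib_right)
  qed
  also have "\<dots> = (fact n / n + d) * T"
    by (simp add: T_def sum_distrib_left)
  also have "fact n / n + d = fact n / (real n - 1)"
    using assms(2) unfolding d_def n_def by (simp add: field_simps)
  finally show ?thesis unfolding n_def T_def .
qed

section \<open>Total intersection and its upper bound\<close>

text \<open>Double counting of the triples \<open>(A, B, i)\<close> with \<open>A i = B i\<close>:
  for fixed \<open>i\<close> and common value \<open>j\<close>, both \<open>A\<close> and
  \<open>B\<close> range over the same fibre.\<close>

lemma total_intersection_eq_sum_squares:
  assumes "G \<subseteq> sym_perms n" "finite G"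
  shows "real (total_intersection n G)
    = (\<Sum>i\<in>{1..n}. \<Sum>j\<in>{1..n}. (real (card {A \<in> G. A i = j}))\<^sup>2)"
proof -
  have "card {i \<in> {1..n}. A i = B i} = (\<Sum>i\<in>{1..n}. if B i = A i then 1 else 0)"
    for A B :: "nat \<Rightarrow> nat"
    by (auto simp: sum.If_cases intro!: arg_cong[where f = card])
  then have "total_intersection n G = (\<Sum>A\<in>G. \<Sum>B\<in>G. \<Sum>i\<in>{1..n}. if B i = A i then 1 else 0)"
    unfolding total_intersection_def by simp
  also have "\<dots> = (\<Sum>A\<in>G. \<Sum>i\<in>{1..n}. card {B \<in> G. B i = A i})"
    by (subst sum.swap) (simp add: sum.If_cases assms(2) Int_def)
  also have "\<dots> = (\<Sum>i\<in>{1..n}. \<Sum>A\<in>G. card {B \<in> G. B i = A i})"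
    by (rule sum.swap)
  finally have "real (total_intersection n G)
      = (\<Sum>i\<in>{1..n}. \<Sum>A\<in>G. real (card {B \<in> G. B i = A i}))" by simp
  also have "\<dots> = (\<Sum>i\<in>{1..n}. \<Sum>j\<in>{1..n}. real (card {A \<in> G. A i = j}) * real (card {A \<in> G. A i = j}))"
  proof (rule sum.cong[OF refl])
    fix i assume i: "i \<in> {1..n}"
    have "A i \<in> {1..n}" if "A \<in> G" for A
      using that assms(1) permutes_in_image[of A "{1..n}" i] i by (auto simp: sym_perms_def)
    then show "(\<Sum>A\<in>G. real (card {B \<in> G. B i = A i}))
        = (\<Sum>j\<in>{1..n}. real (card {A \<in> G. A i = j}) * real (card {A \<in> G. A i = j}))"
      \<comment> \<open>The summand is itself the fibre size, so weighting it by the fibre size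
        produces the square.\<close>
      using assms(2)
      by (intro sum_by_value[where f = "\<lambda>j. real (card {B \<in> G. B i = j})"]) auto
  qed
  finally show ?thesis by (simp add: power2_eq_square)
qed

text \<open>This is the bound of the theorem with the square of the cardinality multiplied into the
  bracket, so that no division by \<open>card G\<close> occurs.\<close>

lemma total_intersection_le:
  assumes n: "n \<ge> 2" and G: "G \<subseteq> sym_perms n"
  shows "real (total_intersection n G)
    \<le> (real (card G) * fact n + (real (card G))\<^sup>2 * (real n - 2)) / (real n - 1)"
proof -
  define S where "S = {1..n}"
  define M where "M = real (card G)"
  define a where "a i j = real (card {A \<in> G. A i = j})" for i j
  define b where "b i j = a i j - M / n" for i j
  define T where "T = (\<Sum>i\<in>S. \<Sum>j\<in>S. (b i j)\<^sup>2)"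
  define g where "g A = (\<Sum>i\<in>S. b i (A i))" for A :: "nat \<Rightarrow> nat"
  define P where "P = {p. p permutes S}"
  have S: "finite S" "card S = n" by (auto simp: S_def)
  have GP: "G \<subseteq> P" using G by (simp add: P_def S_def sym_perms_def)
  have finP: "finite P" and cardP: "card P = fact n"
    using finite_permutations[OF S(1)] card_permutations[OF S(2,1)] by (auto simp: P_def)
  have finG: "finite G" using GP finP finite_subset by blast
  have inS: "A i \<in> S" if "A \<in> G" "i \<in> S" for A i
    using that GP permutes_in_image by (fastforce simp: P_def)
  have sum_G: "(\<Sum>A\<in>G. f (A i)) = (\<Sum>j\<in>S. a i j * f j)" if "i \<in> S" for f i
    unfolding a_def using inS that finG S(1) by (intro sum_by_value) auto
  have "(\<Sum>j\<in>S. a i j) = M" if "i \<in> S" for i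
    using sum_G[OF that, of "\<lambda>_. 1"] by (simp add: M_def)
  then have row: "(\<Sum>j\<in>S. b i j) = 0" if "i \<in> S" for i
    using that n by (simp add: b_def sum_subtractf S(2))
  have "(\<Sum>i\<in>S. a i j) = M" if j: "j \<in> S" for j
  proof -
    \<comment> \<open>A permutation takes the value \<open>j\<close> exactly once, so each
      \<open>A\<close> contributes 1 to column \<open>j\<close>.\<close>
    have "card {i \<in> S. A i = j} = 1" if "A \<in> G" for A
    proof -
      have p: "A permutes S" using that GP by (auto simp: P_def)
      then have "{i \<in> S. A i = j} = {inv A j}"
        using j permutes_inverses[OF p] permutes_in_image[OF permutes_inv[OF p]] by auto
      then show ?thesis by simp
    qed
    then have "M = (\<Sum>A\<in>G. real (card {i \<in> S. A i = j}))" by (simp add: M_def)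
    also have "\<dots> = (\<Sum>A\<in>G. \<Sum>i\<in>S. if A i = j then 1 else 0)"
      by (simp add: sum.If_cases S(1) Int_def)
    also have "\<dots> = (\<Sum>i\<in>S. a i j)"
      by (subst sum.swap) (simp add: sum.If_cases finG Int_def a_def)
    finally show ?thesis by simp
  qed
  then have col: "(\<Sum>i\<in>S. b i j) = 0" if "j \<in> S" for j
    using that n by (simp add: b_def sum_subtractf S(2))
  \<comment> \<open>\<open>a\<close> and \<open>b\<close> differ by a constant, which pairs to zero
    with each row of \<open>b\<close>.\<close>
  have ab: "(\<Sum>j\<in>S. a i j * b i j) = (\<Sum>j\<in>S. (b i j)\<^sup>2)" if "i \<in> S" for i
  proof -
    have "(\<Sum>j\<in>S. a i j * b i j) = (\<Sum>j\<in>S. (b i j)\<^sup>2 + M / n * b i j)"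
      by (rule sum.cong) (simp_all add: b_def power2_eq_square algebra_simps)
    then show ?thesis unfolding sum.distrib sum_distrib_left[symmetric] using row[OF that] by simp
  qed
  have gG: "(\<Sum>A\<in>G. g A) = T"
    unfolding g_def T_def by (subst sum.swap) (simp add: sum_G ab)
  have gP: "(\<Sum>A\<in>P. g A) = 0"
    unfolding g_def P_def
    by (subst sum.swap) (simp add: sum_permutes_value[OF S(1)] row)
  have g2: "(\<Sum>A\<in>P. (g A)\<^sup>2) = fact n / (real n - 1) * T"
    using sum_square_permutes[of S b] row col S n by (simp add: P_def g_def T_def)
  have "real (total_intersection n G) = (\<Sum>i\<in>S. \<Sum>j\<in>S. (a i j)\<^sup>2)"
    using total_intersection_eq_sum_squares[OF G finG] by (simp add: a_def S_def)
  \<comment> \<open>The cross term vanishes with the row sum of \<open>b\<close>.\<close>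
  also have "\<dots> = (\<Sum>i\<in>S. (\<Sum>j\<in>S. (b i j)\<^sup>2) + M\<^sup>2 / n)"
  proof (rule sum.cong[OF refl])
    fix i assume i: "i \<in> S"
    have "(\<Sum>j\<in>S. (a i j)\<^sup>2) = (\<Sum>j\<in>S. (b i j)\<^sup>2 + 2 * (M / n) * b i j + (M / n)\<^sup>2)"
    proof (rule sum.cong[OF refl])
      fix j
      have "a i j = b i j + M / n" by (simp add: b_def)
      then show "(a i j)\<^sup>2 = (b i j)\<^sup>2 + 2 * (M / n) * b i j + (M / n)\<^sup>2"
        by (simp only: power2_sum) simp
    qed
    also have "\<dots> = (\<Sum>j\<in>S. (b i j)\<^sup>2) + n * (M / n)\<^sup>2"
      unfolding sum.distrib sum_distrib_left[symmetric] using row[OF i] S(2) by simp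
    also have "n * (M / n)\<^sup>2 = M\<^sup>2 / n" by (simp add: power2_eq_square)
    finally show "(\<Sum>j\<in>S. (a i j)\<^sup>2) = (\<Sum>j\<in>S. (b i j)\<^sup>2) + M\<^sup>2 / n" .
  qed
  also have "\<dots> = T + M\<^sup>2"
    using n S(2) by (simp add: T_def sum.distrib)
  finally have I: "real (total_intersection n G) = T + M\<^sup>2" .
  \<comment> \<open>This is the minimiser of
    \<open>t\<^sup>2 * (fact n / (real n - 1) * T) - 2 * t * T\<close> when \<open>T > 0\<close>,
    that is, the coefficient of the projection of the indicator of \<open>G\<close> onto
    \<open>g\<close>.\<close>
  define t where "t = (real n - 1) / fact n"
  define u where "u A = (if A \<in> G then 1 else 0 :: real)" for A
  have uG: "(\<Sum>A\<in>P. u A * f A) = (\<Sum>A\<in>G. f A)" for f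
  proof -
    have "(\<Sum>A\<in>P. u A * f A) = (\<Sum>A\<in>P. if A \<in> G then f A else 0)"
      by (rule sum.cong) (simp_all add: u_def)
    also have "\<dots> = (\<Sum>A\<in>G. f A)"
      using GP finP by (simp add: sum.If_cases Int_absorb1)
    finally show ?thesis .
  qed
  have uu: "u A * u A = u A" for A by (simp add: u_def)
  have "0 \<le> (\<Sum>A\<in>P. (u A - M / fact n - t * g A)\<^sup>2)"
    by (intro sum_nonneg) simp
  \<comment> \<open>The square of the indicator \<open>u\<close> is \<open>u\<close>. The factor 1
    is written out so that \<open>uG\<close> applies with a constant function.\<close>
  also have "\<dots> = (\<Sum>A\<in>P. (1 - 2 * (M / fact n)) * (u A * 1) - 2 * t * (u A * g A)
      + (M / fact n)\<^sup>2 + 2 * (M / fact n) * t * g A + t\<^sup>2 * (g A)\<^sup>2)"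
    by (rule sum.cong[OF refl]) (use uu in \<open>simp add: power2_eq_square algebra_simps\<close>)
  also have "\<dots> = (1 - 2 * (M / fact n)) * M - 2 * t * T + fact n * (M / fact n)\<^sup>2
      + t\<^sup>2 * (fact n / (real n - 1) * T)"
    unfolding sum.distrib sum_subtractf sum_distrib_left[symmetric] uG gG gP g2
    by (simp add: M_def cardP)
  also have "fact n * (M / fact n)\<^sup>2 = M\<^sup>2 / fact n"
    by (simp add: power2_eq_square)
  also have "t\<^sup>2 * (fact n / (real n - 1) * T) = t * T"
    using n by (simp add: t_def power2_eq_square)
  finally have "t * T \<le> M - M\<^sup>2 / fact n"
    by (simp add: power2_eq_square algebra_simps)
  \<comment> \<open>Since \<open>fact n * t = real n - 1\<close>, this clears the factorials from
    the denominators.\<close>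
  then have "fact n * (t * T) \<le> fact n * (M - M\<^sup>2 / fact n)"
    by (rule mult_left_mono) simp
  then have "(real n - 1) * T \<le> fact n * M - M\<^sup>2"
    using n by (simp add: t_def right_diff_distrib)
  then have "(T + M\<^sup>2) * (real n - 1) \<le> M * fact n + M\<^sup>2 * (real n - 2)"
    by (simp add: algebra_simps)
  then show ?thesis
    unfolding I M_def[symmetric] using n by (simp add: pos_le_divide_eq)
qed

theorem theorem1p8:
  fixes n M :: nat and F :: "(nat \<Rightarrow> nat) set"
  assumes "n \<ge> 2" and "M \<ge> 1" and "M \<le> fact n"
    and "F \<subseteq> sym_perms n" and "card F = M"
  shows "real (max_total_intersection n F)
           \<le> (real M)\<^sup>2 / (real n - 1) * (fact n / real M + real n - 2)"
proof -
  let ?X = "{total_intersection n G | G. G \<subseteq> sym_perms n \<and> card G = card F}"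
  have "finite (sym_perms n)"
    by (simp add: sym_perms_def finite_permutations)
  then have "finite (total_intersection n ` Pow (sym_perms n))" by simp
  then have "finite ?X" by (rule rev_finite_subset) auto
  \<comment> \<open>\<open>F\<close> itself is an admissible family. With finiteness, the maximum is
    attained by some \<open>G\<close>, to which the bound applies.\<close>
  moreover have "?X \<noteq> {}" using assms(4) by auto
  ultimately have "max_total_intersection n F \<in> ?X"
    unfolding max_total_intersection_def by (rule Max_in)
  then obtain G where G: "G \<subseteq> sym_perms n" "card G = M"
    and eq: "max_total_intersection n F = total_intersection n G"
    using assms(5) by auto
  have "real (total_intersection n G)
      \<le> (real M * fact n + (real M)\<^sup>2 * (real n - 2)) / (real n - 1)"
    using total_intersection_le[OF assms(1) G(1)] G(2) by simp
  also have "\<dots> = (real M)\<^sup>2 / (real n - 1) * (fact n / real M + real n - 2)"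
    using assms(1,2) by (simp add: field_simps power2_eq_square)
  finally show ?thesis using eq by simp
qed

end
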